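(* Let $X$ be a Banach space, let $g:[0,1]\to X$ be strongly measurable, and let $G:[0,1]\to ck(X)$ be the multifunction determined by $g$, i.e. $G(t)=\mathrm{conv}\{0,g(t)\}$ for every $t\in[0,1]$. Then $G$ is Bochner integrable (that is, $G$ is Bochner measurable and integrably bounded) if and only if $g$ is Bochner integrable.
   Context: $[0,1]$ carries Lebesgue measure $\lambda$. $ck(X)$ is the family of all nonempty convex compact subsets of $X$, with the Hausdorff metric $d_H$; for $C\subset X$, $|C|:=\sup\{\|x\|:x\in C\}$. A multifunction is simple if it is measurable and has only finitely many values. $G:[0,1]\to ck(X)$ is Bochner measurable if there is a sequence of simple multifunctions $G_n:[0,1]\to ck(X)$ with $\lim_n d_H(G_n(t),G(t))=0$ for almost all $t\in[0,1]$. $G$ is integrably bounded if there is a Lebesgue integrable $h:[0,1]\to\mathbb{R}$ with $|G(t)|\le h(t)$ for almost all $t$. *)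

theory Defs
  imports "HOL-Analysis.Analysis"
begin

text \<open>The library's \<^const>\<open>integrable\<close> is restricted to second-countable (separable) Banach spaces.
  The notions for functions with values in an arbitrary Banach space are therefore introduced here.
  The integrals of the approximating simple functions are automatically Cauchy and hence convergent, so no separate
  convergence condition on them is needed.\<close>

definition strongly_measurable :: "'a measure \<Rightarrow> ('a \<Rightarrow> 'b::real_normed_vector) \<Rightarrow> bool" where
  "strongly_measurable M g \<longleftrightarrow>
     (\<exists>s. (\<forall>n::nat. simple_function M (s n)) \<and> (AE t in M. (\<lambda>n. s n t) \<longlonglongrightarrow> g t))"

definition bochner_integrable :: "'a measure \<Rightarrow> ('a \<Rightarrow> 'b::banach) \<Rightarrow> bool" where
  "bochner_integrable M g \<longleftrightarrow>
     strongly_measurable M g \<and>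
     (\<exists>s. (\<forall>n::nat. Bochner_Integration.simple_bochner_integrable M (s n)) \<and>
          (\<lambda>n. \<integral>\<^sup>+t. ennreal (norm (g t - s n t)) \<partial>M) \<longlonglongrightarrow> 0)"

definition ck :: "'b::real_normed_vector set set" where
  "ck = {C. C \<noteq> {} \<and> convex C \<and> compact C}"

text \<open>The two notions below are only meaningful on nonempty bounded sets, where the real suprema are
  taken over nonempty bounded sets of reals.\<close>

definition hausdorff_dist :: "'b::metric_space set \<Rightarrow> 'b set \<Rightarrow> real" where
  "hausdorff_dist A B = max (SUP x\<in>A. infdist x B) (SUP y\<in>B. infdist y A)"

definition set_norm :: "'b::real_normed_vector set \<Rightarrow> real" where
  "set_norm C = (SUP x\<in>C. norm x)"

text \<open>Multifunctions on \<open>space M\<close> are total functions whose values outside \<open>space M\<close> are irrelevant.\<close>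

definition measurable_multifunction :: "'a measure \<Rightarrow> ('a \<Rightarrow> 'b::topological_space set) \<Rightarrow> bool" where
  "measurable_multifunction M G \<longleftrightarrow>
     (\<forall>U. open U \<longrightarrow> {t \<in> space M. G t \<inter> U \<noteq> {}} \<in> sets M)"

definition simple_multifunction :: "'a measure \<Rightarrow> ('a \<Rightarrow> 'b::topological_space set) \<Rightarrow> bool" where
  "simple_multifunction M G \<longleftrightarrow> measurable_multifunction M G \<and> finite (G ` space M)"

definition bochner_measurable_multifunction ::
    "'a measure \<Rightarrow> ('a \<Rightarrow> 'b::real_normed_vector set) \<Rightarrow> bool" where
  "bochner_measurable_multifunction M G \<longleftrightarrow>
     G \<in> space M \<rightarrow> ck \<and>
     (\<exists>S. (\<forall>n::nat. S n \<in> space M \<rightarrow> ck \<and> simple_multifunction M (S n)) \<and>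
          (AE t in M. (\<lambda>n. hausdorff_dist (S n t) (G t)) \<longlonglongrightarrow> 0))"

definition integrably_bounded :: "'a measure \<Rightarrow> ('a \<Rightarrow> 'b::real_normed_vector set) \<Rightarrow> bool" where
  "integrably_bounded M G \<longleftrightarrow>
     (\<exists>h :: 'a \<Rightarrow> real. integrable M h \<and> (AE t in M. set_norm (G t) \<le> h t))"

definition bochner_integrable_multifunction ::
    "'a measure \<Rightarrow> ('a \<Rightarrow> 'b::real_normed_vector set) \<Rightarrow> bool" where
  "bochner_integrable_multifunction M G \<longleftrightarrow>
     bochner_measurable_multifunction M G \<and> integrably_bounded M G"

end

theory Submission
  imports Defs
begin

text \<open>The map \<open>x \<mapsto> conv {0, x}\<close> is nonexpansive from the norm to the Hausdorff distance and satisfies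
  \<open>|conv {0, x}| = norm x\<close>. Hence simple functions approximating \<open>g\<close> give simple multifunctions
  approximating \<open>G\<close>, and \<open>G\<close> is integrably bounded iff \<open>norm g\<close> has finite integral. The latter
  is equivalent to Bochner integrability of the strongly measurable \<open>g\<close>: truncate the approximating
  simple functions to \<open>{norm s\<^sub>n \<le> 2 * norm g}\<close> and apply dominated convergence.\<close>

section \<open>Norm and Hausdorff distance of segments from the origin\<close>

lemma set_norm_convex_hull_zero:
  fixes x :: "'a::real_normed_vector"
  shows "set_norm (convex hull {0, x}) = norm x"
  unfolding set_norm_def
proof (rule cSup_eq_maximum)
  show "norm x \<in> norm ` (convex hull {0, x})"
    by (intro imageI hull_inc) auto
next
  fix r assume "r \<in> norm ` (convex hull {0, x})"
  then obtain u where "0 \<le> u" "u \<le> 1" "r = norm (u *\<^sub>R x)"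
    by (auto simp: segment_convex_hull[symmetric] closed_segment_def)
  then show "r \<le> norm x"
    by (simp add: mult_left_le_one_le)
qed

text \<open>The point \<open>u *\<^sub>R x\<close> of one segment is matched with
  \<open>u *\<^sub>R y\<close>, which has the same coefficient; scaling by \<open>u\<close> in the
  unit interval does not increase the distance.\<close>

lemma infdist_convex_hull_zero_le:
  fixes x y :: "'a::real_normed_vector"
  assumes "z \<in> convex hull {0, x}"
  shows "infdist z (convex hull {0, y}) \<le> norm (x - y)"
proof -
  obtain u where u: "0 \<le> u" "u \<le> 1" "z = u *\<^sub>R x"
    using assms by (auto simp: segment_convex_hull[symmetric] closed_segment_def)
  have "u *\<^sub>R y \<in> convex hull {0, y}"
    using u by (auto simp: segment_convex_hull[symmetric] closed_segment_def)
  then have "infdist z (convex hull {0, y}) \<le> dist z (u *\<^sub>R y)"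
    by (rule infdist_le)
  also have "\<dots> = u * norm (x - y)"
    using u by (simp add: dist_norm flip: scaleR_diff_right)
  also have "\<dots> \<le> norm (x - y)"
    using u by (simp add: mult_left_le_one_le)
  finally show ?thesis .
qed

lemma hausdorff_dist_convex_hull_zero_le:
  fixes x y :: "'a::real_normed_vector"
  shows "hausdorff_dist (convex hull {0, x}) (convex hull {0, y}) \<le> norm (x - y)"
  unfolding hausdorff_dist_def
proof (rule max.boundedI)
  show "(SUP z\<in>convex hull {0, x}. infdist z (convex hull {0, y})) \<le> norm (x - y)"
    by (rule cSUP_least) (simp_all add: infdist_convex_hull_zero_le)
  show "(SUP z\<in>convex hull {0, y}. infdist z (convex hull {0, x})) \<le> norm (x - y)"
    unfolding norm_minus_commute[of x y]
    by (rule cSUP_least) (simp_all add: infdist_convex_hull_zero_le)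
qed

text \<open>Lower half of a later squeeze. A real supremum dominates its terms only over a set
  bounded above; here the distances to \<open>B\<close> are at most those to a fixed
  \<open>b\<close>, which stay bounded on \<open>A\<close>.\<close>

lemma hausdorff_dist_nonneg:
  assumes "A \<noteq> {}" "bounded A" "B \<noteq> {}"
  shows "0 \<le> hausdorff_dist A B"
proof -
  obtain a b where ab: "a \<in> A" "b \<in> B" using assms by blast
  obtain e where e: "\<And>x. x \<in> A \<Longrightarrow> dist b x \<le> e"
    using assms(2) by (auto simp: bounded_any_center[where a=b])
  have "bdd_above ((\<lambda>x. infdist x B) ` A)"
    using e infdist_le[OF ab(2)] by (auto simp: bdd_above_def dist_commute intro: order_trans)
  then have "infdist a B \<le> (SUP x\<in>A. infdist x B)"
    using ab by (intro cSUP_upper)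
  then show ?thesis
    unfolding hausdorff_dist_def using infdist_nonneg[of a B] by linarith
qed

lemma convex_hull_finite_in_ck:
  fixes F :: "'a::real_normed_vector set"
  assumes "finite F" "F \<noteq> {}"
  shows "convex hull F \<in> ck"
  unfolding ck_def using finite_imp_compact_convex_hull[OF assms(1)] assms(2) by simp

section \<open>Measurability of multifunctions and of norms\<close>

text \<open>Under a simple function the preimage of any set is a finite union of measurable fibres;
  this is applied to \<open>{x. H x \<inter> U \<noteq> {}}\<close>.\<close>

lemma simple_multifunction_comp:
  assumes "simple_function M s"
  shows "simple_multifunction M (\<lambda>t. H (s t))"
proof -
  have "{t \<in> space M. H (s t) \<inter> U \<noteq> {}} \<in> sets M" for U
  proof -
    have "{t \<in> space M. H (s t) \<inter> U \<noteq> {}} = s -` {x. H x \<inter> U \<noteq> {}} \<inter> space M"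
      by blast
    then show ?thesis
      using simple_functionD(2)[OF assms] by (simp only:)
  qed
  moreover have "finite ((\<lambda>t. H (s t)) ` space M)"
    using finite_imageI[OF simple_functionD(1)[OF assms], of H] by (simp only: image_image)
  ultimately show ?thesis
    unfolding simple_multifunction_def measurable_multifunction_def by blast
qed

lemma bochner_measurable_multifunction_convex_hull_zero:
  assumes "strongly_measurable M g"
    and G: "\<And>t. t \<in> space M \<Longrightarrow> G t = convex hull {0, g t}"
  shows "bochner_measurable_multifunction M G"
  unfolding bochner_measurable_multifunction_def
proof (intro conjI)
  show "G \<in> space M \<rightarrow> ck"
    by (intro funcsetI) (simp add: G convex_hull_finite_in_ck)
  obtain s where s: "\<And>n::nat. simple_function M (s n)"
    and lim: "AE t in M. (\<lambda>n. s n t) \<longlonglongrightarrow> g t"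
    using assms(1) by (auto simp: strongly_measurable_def)
  let ?S = "\<lambda>n t. convex hull {0, s n t}"
  have "AE t in M. (\<lambda>n. hausdorff_dist (?S n t) (G t)) \<longlonglongrightarrow> 0"
    using lim AE_space
  proof eventually_elim
    case (elim t)
    have "(\<lambda>n. norm (s n t - g t)) \<longlonglongrightarrow> 0"
      using elim(1) by (simp add: LIM_zero tendsto_norm_zero)
    then show ?case
    proof (rule tendsto_sandwich[OF _ _ tendsto_const, rotated 2])
      show "\<forall>\<^sub>F n in sequentially. 0 \<le> hausdorff_dist (?S n t) (G t)"
        using G[OF elim(2)]
        by (intro always_eventually allI hausdorff_dist_nonneg)
          (auto intro: finite_imp_bounded_convex_hull)
      show "\<forall>\<^sub>F n in sequentially. hausdorff_dist (?S n t) (G t) \<le> norm (s n t - g t)"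
        using G[OF elim(2)] by (simp add: hausdorff_dist_convex_hull_zero_le)
    qed
  qed
  moreover have "?S n \<in> space M \<rightarrow> ck \<and> simple_multifunction M (?S n)" for n
    using simple_multifunction_comp[OF s] by (simp add: convex_hull_finite_in_ck)
  ultimately show "\<exists>S. (\<forall>n::nat. S n \<in> space M \<rightarrow> ck \<and> simple_multifunction M (S n)) \<and>
      (AE t in M. (\<lambda>n. hausdorff_dist (S n t) (G t)) \<longlonglongrightarrow> 0)"
    by (intro exI[of _ ?S]) simp
qed

text \<open>The measure need not be complete, so \<open>norm g\<close> itself may fail to be measurable.\<close>

lemma strongly_measurable_norm_AE:
  assumes "strongly_measurable M g"
  obtains h :: "'a \<Rightarrow> real" where "h \<in> borel_measurable M" "AE t in M. norm (g t) = h t"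
proof -
  obtain s where s: "\<And>n::nat. simple_function M (s n)"
    and lim: "AE t in M. (\<lambda>n. s n t) \<longlonglongrightarrow> g t"
    using assms by (auto simp: strongly_measurable_def)
  have [measurable]: "(\<lambda>t. norm (s n t)) \<in> borel_measurable M" for n
    using simple_function_compose1[OF s] by (rule borel_measurable_simple_function)
  \<comment> \<open>The pointwise \<open>lim\<close> of real measurable functions is measurable
    whatever default value it takes where the sequence diverges, so it serves as
    \<open>h\<close>.\<close>
  have "AE t in M. norm (g t) = lim (\<lambda>n. norm (s n t))"
    using lim by eventually_elim (metis limI tendsto_norm)
  moreover have "(\<lambda>t. lim (\<lambda>n. norm (s n t))) \<in> borel_measurable M"
    by measurable
  ultimately show thesis using that by blast
qed

text \<open>Makes \<open>strongly_measurable_norm_AE\<close> applicable to approximation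
  errors.\<close>

lemma strongly_measurable_diff_simple:
  assumes "strongly_measurable M g" "simple_function M f"
  shows "strongly_measurable M (\<lambda>t. g t - f t)"
proof -
  obtain s where s: "\<And>n::nat. simple_function M (s n)"
    and lim: "AE t in M. (\<lambda>n. s n t) \<longlonglongrightarrow> g t"
    using assms by (auto simp: strongly_measurable_def)
  have "AE t in M. (\<lambda>n. s n t - f t) \<longlonglongrightarrow> g t - f t"
    using lim by eventually_elim (intro tendsto_diff tendsto_const)
  then show ?thesis
    unfolding strongly_measurable_def using simple_function_diff[OF s assms(2)]
    by (intro exI[of _ "\<lambda>n t. s n t - f t"]) simp
qed

section \<open>Bochner integrability and integrable bounds on the norm\<close>

text \<open>A single approximant at finite \<open>L1\<close> distance from \<open>g\<close> is
  enough: its norm plus the norm of the error bounds \<open>norm (g t)\<close>.\<close>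

lemma bochner_integrable_norm_bound:
  assumes "bochner_integrable M g"
  obtains h :: "'a \<Rightarrow> real" where "integrable M h" "AE t in M. norm (g t) \<le> h t"
proof -
  obtain s where sm: "strongly_measurable M g"
    and s: "\<And>n::nat. Bochner_Integration.simple_bochner_integrable M (s n)"
    and lim: "(\<lambda>n. \<integral>\<^sup>+t. ennreal (norm (g t - s n t)) \<partial>M) \<longlonglongrightarrow> 0"
    using assms by (auto simp: bochner_integrable_def)
  obtain n where n: "(\<integral>\<^sup>+t. ennreal (norm (g t - s n t)) \<partial>M) < \<infinity>"
    using order_tendstoD(2)[OF lim, of \<infinity>] by (auto simp: eventually_sequentially)
  have sf: "simple_function M (s n)"
    using s by (auto simp: simple_bochner_integrable.simps)
  \<comment> \<open>The nonnegative integral of the error makes sense without measurability, but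
    \<open>integrable\<close> demands it, hence the measurable version \<open>d\<close>.\<close>
  obtain d where [measurable]: "d \<in> borel_measurable M" and d: "AE t in M. norm (g t - s n t) = d t"
    using strongly_measurable_norm_AE[OF strongly_measurable_diff_simple[OF sm sf]] by blast
  have "integrable M d"
  proof (rule integrableI_nonneg)
    show "AE t in M. 0 \<le> d t"
      using d by eventually_elim (metis norm_ge_zero)
    have "(\<integral>\<^sup>+t. ennreal (d t) \<partial>M) = (\<integral>\<^sup>+t. ennreal (norm (g t - s n t)) \<partial>M)"
      by (rule nn_integral_cong_AE) (use d in eventually_elim, simp)
    then show "(\<integral>\<^sup>+t. ennreal (d t) \<partial>M) < \<infinity>"
      using n by simp
  qed simp
  moreover have "integrable M (\<lambda>t. norm (s n t))"
  proof -
    have "Bochner_Integration.simple_bochner_integrable M (\<lambda>t. norm (s n t))"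
      using s[of n] simple_function_compose1[OF sf, of norm]
      by (auto simp: simple_bochner_integrable.simps)
    then show ?thesis
      using has_bochner_integral_simple_bochner_integrable integrable.intros by blast
  qed
  moreover have "AE t in M. norm (g t) \<le> d t + norm (s n t)"
    using d by eventually_elim (metis norm_triangle_sub add.commute)
  ultimately show thesis
    by (intro that[of "\<lambda>t. d t + norm (s n t)"] Bochner_Integration.integrable_add)
qed

text \<open>Only finite measure of the support is at stake. The finitely many nonzero values have
  norm at least some \<open>\<delta> > 0\<close>, so \<open>h\<close> is at least
  \<open>\<delta>\<close> on the support and Markov's inequality applies.\<close>

lemma simple_bochner_integrable_bounded:
  fixes h :: "'a \<Rightarrow> real"
  assumes f: "simple_function M f" and h: "integrable M h"
    and le: "\<And>t. t \<in> space M \<Longrightarrow> f t \<noteq> 0 \<Longrightarrow> norm (f t) \<le> h t"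
  shows "Bochner_Integration.simple_bochner_integrable M f"
proof -
  have [measurable]: "h \<in> borel_measurable M" using h by auto
  have fin: "finite (norm ` (f ` space M - {0}))"
    using simple_functionD(1)[OF f] by auto
  \<comment> \<open>Inserting \<open>1\<close> keeps the minimum meaningful when \<open>f\<close>
    vanishes on \<open>space M\<close>.\<close>
  define \<delta> where "\<delta> = Min (insert 1 (norm ` (f ` space M - {0})))"
  have \<delta>: "0 < \<delta>"
    unfolding \<delta>_def using fin by (subst Min_gr_iff) auto
  have \<delta>_le: "\<delta> \<le> norm (f t)" if "t \<in> space M" "f t \<noteq> 0" for t
    unfolding \<delta>_def using that fin by (intro Min_le) auto
  have "emeasure M {t \<in> space M. f t \<noteq> 0} \<le> emeasure M {t \<in> space M. h t \<ge> \<delta>}"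
    using \<delta>_le le by (intro emeasure_mono) (auto intro: order_trans)
  \<comment> \<open>Markov's inequality requires a nonnegative function, and \<open>h\<close> may be
    negative off the support of \<open>f\<close>.\<close>
  also have "\<dots> \<le> emeasure M {t \<in> space M. \<delta> \<le> norm (h t)}"
    by (intro emeasure_mono) auto
  also have "\<dots> < \<infinity>"
    using integral_Markov_inequality[OF integrable_norm[OF h] _ \<delta>]
    by (auto intro: le_less_trans)
  finally show ?thesis
    using f by (intro simple_bochner_integrable.intros) auto
qed

lemma bochner_integrableI_bounded:
  fixes g :: "'a \<Rightarrow> 'b::banach" and b :: "'a \<Rightarrow> real"
  assumes sm: "strongly_measurable M g"
    and b: "integrable M b" "AE t in M. norm (g t) \<le> b t"
  shows "bochner_integrable M g"
proof -
  obtain s where s: "\<And>n::nat. simple_function M (s n)"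
    and lim: "AE t in M. (\<lambda>n. s n t) \<longlonglongrightarrow> g t"
    using sm by (auto simp: strongly_measurable_def)
  obtain h where [measurable]: "h \<in> borel_measurable M" and h: "AE t in M. norm (g t) = h t"
    using strongly_measurable_norm_AE[OF sm] by blast
  have "AE t in M. norm (h t) \<le> norm (b t)"
    using h b(2)
  proof eventually_elim
    case (elim t)
    then show ?case using norm_ge_zero[of "g t"] by simp
  qed
  then have hint: "integrable M h"
    using b(1) by (intro Bochner_Integration.integrable_bound[of M b h]) auto
  \<comment> \<open>Truncating by \<open>h\<close> instead of \<open>norm (g t)\<close> keeps
    \<open>s' n\<close> measurable. The factor 2 leaves room: where \<open>g t \<noteq> 0\<close>,
    the truncation is eventually inactive.\<close>
  define s' where "s' n t = (if norm (s n t) \<le> 2 * h t then s n t else 0)" for n t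
  have norm_meas [measurable]: "(\<lambda>t. norm (s n t)) \<in> borel_measurable M" for n
    using simple_function_compose1[OF s] by (rule borel_measurable_simple_function)
  have s': "simple_function M (s' n)" for n
    unfolding s'_def by (intro simple_function_If s simple_function_const) measurable
  have sb: "Bochner_Integration.simple_bochner_integrable M (s' n)" for n
    by (rule simple_bochner_integrable_bounded[OF s', of "\<lambda>t. 2 * h t"])
      (use hint in \<open>auto simp: s'_def split: if_splits\<close>)
  have "\<exists>d. d \<in> borel_measurable M \<and> (AE t in M. norm (g t - s' n t) = d t)" for n
    using strongly_measurable_norm_AE[OF strongly_measurable_diff_simple[OF sm s'[of n]]] by blast
  then obtain d where [measurable]: "\<And>n. d n \<in> borel_measurable M"
    and d: "\<And>n. AE t in M. norm (g t - s' n t) = d n t"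
    by metis
  \<comment> \<open>The constant 3 is 1 for \<open>g\<close> plus 2 for the truncated
    approximant.\<close>
  have dom: "AE t in M. ennreal (d n t) \<le> ennreal (3 * h t)" for n
    using d[of n] h
  proof eventually_elim
    case (elim t)
    have "d n t \<le> norm (g t) + norm (s' n t)"
      using elim(1) norm_triangle_ineq4[of "g t" "s' n t"] by simp
    also have "norm (s' n t) \<le> 2 * norm (g t)"
      by (auto simp: s'_def simp flip: elim(2))
    finally show ?case using elim(2) by (intro ennreal_leI) simp
  qed
  have "AE t in M. \<forall>n. norm (g t - s' n t) = d n t"
    using d by (simp add: AE_all_countable)
  then have conv: "AE t in M. (\<lambda>n. ennreal (d n t)) \<longlonglongrightarrow> 0"
    using h lim
  proof eventually_elim
    case (elim t)
    have "(\<lambda>n. s' n t) \<longlonglongrightarrow> g t"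
    \<comment> \<open>At a zero of \<open>g\<close> there is no such room, but there
      \<open>h t = 0\<close>, so the truncation makes \<open>s' n t\<close> exactly 0.\<close>
    proof (cases "g t = 0")
      case True
      then have "s' n t = 0" for n
        using elim(2) by (simp add: s'_def)
      then show ?thesis using True by simp
    next
      case False
      then have "\<forall>\<^sub>F n in sequentially. norm (s n t) < 2 * norm (g t)"
        by (intro order_tendstoD(2)[OF tendsto_norm[OF elim(3)]]) simp
      then have "\<forall>\<^sub>F n in sequentially. s n t = s' n t"
        by eventually_elim (use elim(2) in \<open>simp add: s'_def\<close>)
      then show ?thesis using elim(3) by (rule Lim_transform_eventually[rotated])
    qed
    then have "(\<lambda>n. norm (g t - s' n t)) \<longlonglongrightarrow> norm (g t - g t)"
      by (intro tendsto_intros)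
    then have "(\<lambda>n. d n t) \<longlonglongrightarrow> 0"
      using elim(1) by simp
    then show ?case using tendsto_ennrealI by fastforce
  qed
  have fin: "(\<integral>\<^sup>+t. ennreal (3 * h t) \<partial>M) < \<infinity>"
  proof -
    have "(\<integral>\<^sup>+t. ennreal (3 * h t) \<partial>M) \<le> (\<integral>\<^sup>+t. ennreal (norm (3 * h t)) \<partial>M)"
      by (intro nn_integral_mono ennreal_leI) simp
    also have "\<dots> < \<infinity>"
      using integrable_mult_right[OF hint, of 3] by (simp only: integrable_iff_bounded)
    finally show ?thesis .
  qed
  have "(\<lambda>n. \<integral>\<^sup>+t. ennreal (d n t) \<partial>M) \<longlonglongrightarrow> (\<integral>\<^sup>+t. 0 \<partial>M)"
    by (rule nn_integral_dominated_convergence[OF _ _ _ dom fin conv]) auto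
  moreover have "(\<integral>\<^sup>+t. ennreal (norm (g t - s' n t)) \<partial>M) = (\<integral>\<^sup>+t. ennreal (d n t) \<partial>M)" for n
    by (rule nn_integral_cong_AE) (use d[of n] in eventually_elim, simp)
  ultimately show ?thesis
    unfolding bochner_integrable_def using sm sb by (intro conjI exI[of _ s']) simp_all
qed

theorem proposition2p2:
  fixes g :: "real \<Rightarrow> 'a::banach" and G :: "real \<Rightarrow> 'a set"
  assumes "strongly_measurable (lebesgue_on {0..1}) g"
    and "\<And>t. t \<in> {0..1} \<Longrightarrow> G t = convex hull {0, g t}"
  shows "bochner_integrable_multifunction (lebesgue_on {0..1}) G \<longleftrightarrow>
         bochner_integrable (lebesgue_on {0..1}) g"
proof -
  let ?M = "lebesgue_on {0..1::real}"
  have G: "G t = convex hull {0, g t}" if "t \<in> space ?M" for t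
    using that assms(2) by simp
  \<comment> \<open>Since \<open>|conv {0, x}| = norm x\<close>, integrable boundedness of
    \<open>G\<close> becomes an integrable bound on \<open>norm (g t)\<close>.\<close>
  have "(AE t in ?M. set_norm (G t) \<le> h t) \<longleftrightarrow> (AE t in ?M. norm (g t) \<le> h t)" for h
    using G by (intro AE_cong) (simp add: set_norm_convex_hull_zero)
  then have "integrably_bounded ?M G \<longleftrightarrow>
      (\<exists>h :: real \<Rightarrow> real. integrable ?M h \<and> (AE t in ?M. norm (g t) \<le> h t))"
    by (simp add: integrably_bounded_def)
  also have "\<dots> \<longleftrightarrow> bochner_integrable ?M g"
    using bochner_integrableI_bounded[OF assms(1)] bochner_integrable_norm_bound by metis
  \<comment> \<open>Strong measurability of \<open>g\<close> already makes \<open>G\<close> Bochner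
    measurable, so integrable boundedness alone decides the equivalence.\<close>
  finally show ?thesis
    using bochner_measurable_multifunction_convex_hull_zero[OF assms(1) G]
    by (simp add: bochner_integrable_multifunction_def)
qed

end
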